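(* Let $\{A_n\}_{n\ge 1}$ and $\{B_n\}_{n\ge 1}$ be sequences of $n\times n$ matrices having exponential decay with respect to common associated distance functions $d_n$, and assume that both sequences have a finite number of indices around each index (with respect to these $d_n$). For $\tau>0$ let $C_n=A_nB_n$, $\bar C_n=\mathrm{SpAMM}(A_n,B_n,\tau)$ and $E_n=C_n-\bar C_n$. Then: (1) for every fixed $n$, $|[E_n]_{i,j}|=O(\tau)$ as $\tau\to 0$, for all $i,j=1,\ldots,n$; (2) for every fixed $\tau>0$, $\|E_n\|_F=O(n^{1/2})$ as $n\to\infty$; (3) for every fixed $n$ and every $p<2$, $\|E_n\|_F=O(\tau^{p/2})$ as $\tau\to 0$.
   Context: Matrices have real or complex entries; $\|\cdot\|_F$ is the Frobenius norm. Distance function: $d_n$ is a distance function on the index set $\{1,\ldots,n\}$ if for all indices $i,j,k$: $d_n(i,j)\ge 0$ (real valued); $d_n(i,j)=d_n(j,i)$; $d_n(i,i)=0$; $d_n(i,j)\le d_n(i,k)+d_n(k,j)$ (i.e. it is a pseudo-metric). For each $n$ one such $d_n$ is given. Exponential decay with respect to common associated distance functions: there exist positive constants $\alpha,c_1,c_2$, independent of $n$, such that for every $n$ and all $i,j=1,\ldots,n$, $$|[A_n]_{i,j}|\le c_1e^{-\alpha d_n(i,j)},\qquad |[B_n]_{i,j}|\le c_2e^{-\alpha d_n(i,j)}.$$ Finite number of indices around each index: there exist positive constants $\gamma,\beta$, independent of $n$, such that for every $n$, every $i=1,\ldots,n$ and every $R\ge 1$, $|N_{d_n}(i,R)|\le\gamma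 R^\beta$, where $N_{d_n}(i,R)=\{j\in\{1,\ldots,n\}: d_n(i,j)\le R\}$ is the set of indices within distance $R$ of $i$, and $|N_{d_n}(i,R)|$ is its cardinality. The SpAMM (sparse approximate matrix multiplication) algorithm: an $n\times n$ matrix is represented as a quad-tree of depth $\lceil\log_2 n\rceil$, padding with zero rows and columns at the end up to size $2^{\lceil\log_2 n\rceil}$ if $n$ is not a power of two; each matrix in the tree is split into four equally sized blocks $A=\begin{pmatrix} A_{0,0} & A_{0,1} \\ A_{1,0} & A_{1,1} \end{pmatrix}$, and the lowest level consists of single matrix elements. The product $C=\mathrm{SpAMM}(A,B,\tau)$ is defined recursively. At the lowest level (single elements), $\mathrm{SpAMM}(A,B,\tau)=AB$. Otherwise $C$ has blocks $C_{i,j}=T_0+T_1$ for $i,j\in\{0,1\}$, where for $k\in\{0,1\}$ $$T_k=\begin{cases}\mathrm{SpAMM}(A_{i,k},B_{k,j},\tau),&\text{if }\|A_{i,k}\|_F\|B_{k,j}\|_F\ge\tau,\\ 0,&\text{otherwise}.\end{cases}$$ (After padding, the result is restricted to the leading $n\times n$ block.) *)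

theory Defs
  imports
    "HOL-Analysis.Analysis"
    "HOL-Library.Landau_Symbols"
    "Jordan_Normal_Form.Matrix"
begin

(* Matrix indices run over 0, ..., n - 1 (library convention) instead of 1, ..., n.
   Entries are taken in the class real_normed_field, which comprises real and complex. *)

definition frobenius_norm :: "'a::real_normed_field mat \<Rightarrow> real" where
  "frobenius_norm A = sqrt (\<Sum>i<dim_row A. \<Sum>j<dim_col A. (norm (A $$ (i, j)))\<^sup>2)"

(* A pseudo-metric: distinct indices may have distance 0. *)
definition distance_function :: "nat \<Rightarrow> (nat \<Rightarrow> nat \<Rightarrow> real) \<Rightarrow> bool" where
  "distance_function n d \<longleftrightarrow>
     (\<forall>i<n. \<forall>j<n. d i j \<ge> 0) \<and>
     (\<forall>i<n. \<forall>j<n. d i j = d j i) \<and>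
     (\<forall>i<n. d i i = 0) \<and>
     (\<forall>i<n. \<forall>j<n. \<forall>k<n. d i j \<le> d i k + d k j)"

definition common_exponential_decay ::
  "(nat \<Rightarrow> nat \<Rightarrow> nat \<Rightarrow> real) \<Rightarrow> (nat \<Rightarrow> 'a::real_normed_field mat) \<Rightarrow> (nat \<Rightarrow> 'a mat) \<Rightarrow> bool"
where
  "common_exponential_decay d A B \<longleftrightarrow>
     (\<exists>\<alpha> c1 c2. \<alpha> > 0 \<and> c1 > 0 \<and> c2 > 0 \<and>
        (\<forall>n\<ge>1. \<forall>i<n. \<forall>j<n.
           norm (A n $$ (i, j)) \<le> c1 * exp (- \<alpha> * d n i j) \<and>
           norm (B n $$ (i, j)) \<le> c2 * exp (- \<alpha> * d n i j)))"

definition index_neighbourhood :: "nat \<Rightarrow> (nat \<Rightarrow> nat \<Rightarrow> real) \<Rightarrow> nat \<Rightarrow> real \<Rightarrow> nat set" where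
  "index_neighbourhood n d i R = {j. j < n \<and> d i j \<le> R}"

definition finite_indices_around :: "(nat \<Rightarrow> nat \<Rightarrow> nat \<Rightarrow> real) \<Rightarrow> bool" where
  "finite_indices_around d \<longleftrightarrow>
     (\<exists>\<gamma> \<beta>. \<gamma> > 0 \<and> \<beta> > 0 \<and>
        (\<forall>n\<ge>1. \<forall>i<n. \<forall>R\<ge>1.
           real (card (index_neighbourhood n (d n) i R)) \<le> \<gamma> * R powr \<beta>))"

(* spamm_tree k is the recursion on a quad-tree of depth k, i.e. on matrices of
   size 2^k.  The threshold test takes place before descending into a pair of
   subblocks, so no test is made at the root. *)
primrec spamm_tree :: "nat \<Rightarrow> real \<Rightarrow> 'a::real_normed_field mat \<Rightarrow> 'a mat \<Rightarrow> 'a mat" where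
  "spamm_tree 0 = (\<lambda>\<tau> A B. A * B)"
| "spamm_tree (Suc k) = (\<lambda>\<tau> A B.
     let m = 2 ^ k;
         T = (\<lambda>X Y. if frobenius_norm X * frobenius_norm Y \<ge> \<tau>
                    then spamm_tree k \<tau> X Y else 0\<^sub>m m m);
         (A00, A01, A10, A11) = split_block A m m;
         (B00, B01, B10, B11) = split_block B m m
     in four_block_mat
          (T A00 B00 + T A01 B10) (T A00 B01 + T A01 B11)
          (T A10 B00 + T A11 B10) (T A10 B01 + T A11 B11))"

definition zero_pad :: "nat \<Rightarrow> 'a::zero mat \<Rightarrow> 'a mat" where
  "zero_pad N A = mat N N (\<lambda>(i, j). if i < dim_row A \<and> j < dim_col A then A $$ (i, j) else 0)"

definition leading_block :: "nat \<Rightarrow> 'a mat \<Rightarrow> 'a mat" where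
  "leading_block n A = mat n n (\<lambda>(i, j). A $$ (i, j))"

definition spamm :: "real \<Rightarrow> 'a::real_normed_field mat \<Rightarrow> 'a mat \<Rightarrow> 'a mat" where
  "spamm \<tau> A B =
     (let n = dim_row A; k = nat \<lceil>log 2 (real n)\<rceil>
      in leading_block n (spamm_tree k \<tau> (zero_pad (2 ^ k) A) (zero_pad (2 ^ k) B)))"

definition spamm_error :: "real \<Rightarrow> 'a::real_normed_field mat \<Rightarrow> 'a mat \<Rightarrow> 'a mat" where
  "spamm_error \<tau> A B = A * B - spamm \<tau> A B"

end

theory Submission
  imports Defs "HOL-Real_Asymp.Real_Asymp"
begin

text \<open>
  Each entry of the SpAMM error is the part of the sum \<open>\<Sum>l. A (i, l) * B (l, j)\<close> that the recursion
  skips. Both bounds used below come from this description.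

  As \<open>\<tau>\<close> tends to \<open>0\<close>: by Cauchy--Schwarz an entry of a block product \<open>X * Y\<close> is at most
  \<open>\<parallel>X\<parallel> * \<parallel>Y\<parallel>\<close>, so each skipped product changes an entry by at most \<open>\<tau>\<close>. A tree of depth \<open>k\<close>
  contributes at most \<open>2 ^ k\<close> products to one entry, so every entry of the error is at most
  \<open>2 ^ k * \<tau>\<close> (\<open>spamm_tree_error_le_threshold\<close>). For fixed \<open>n\<close> this is \<open>O(\<tau>)\<close>, and the Frobenius
  norm, being at most the sum of the absolute values of the entries, is \<open>O(\<tau>)\<close> as well; that is
  stronger than \<open>O(\<tau> powr (p / 2))\<close> with \<open>p < 2\<close>.

  As \<open>n\<close> tends to infinity: whatever is skipped, an entry of the error is at most
  \<open>\<Sum>l. norm (A (i, l)) * norm (B (l, j))\<close> (\<open>spamm_tree_error_le_abs_product\<close>). Hence it inherits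
  exponential decay with half the rate, because half of both exponents together already gives
  \<open>exp (- (\<alpha> / 2) * d i j)\<close> by the triangle inequality, while the other half makes the sum over
  \<open>l\<close> bounded independently of \<open>n\<close> (\<open>exponential_row_sum_bounded\<close>). Squaring and summing over a row
  is again bounded uniformly, so the squared Frobenius norm is \<open>O(n)\<close>, with a constant that does
  not even depend on \<open>\<tau>\<close>.
\<close>

section \<open>Entries and norms of matrices\<close>

lemma mult_mat_entry:
  assumes "A \<in> carrier_mat n m" "B \<in> carrier_mat m k" "i < n" "j < k"
  shows "(A * B) $$ (i, j) = (\<Sum>l<m. A $$ (i, l) * B $$ (l, j))"
  using assms by (auto simp: scalar_prod_def atLeast0LessThan)

lemma norm_mult_mat_entry_le:
  fixes A B :: "'a::real_normed_field mat"
  assumes "A \<in> carrier_mat n m" "B \<in> carrier_mat m k" "i < n" "j < k"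
  shows "norm ((A * B) $$ (i, j)) \<le> (\<Sum>l<m. norm (A $$ (i, l)) * norm (B $$ (l, j)))"
  unfolding mult_mat_entry[OF assms] by (rule sum_norm_le) (simp add: norm_mult)

lemma L2_set_row_le_frobenius_norm:
  assumes "A \<in> carrier_mat n m" "i < n"
  shows "L2_set (\<lambda>l. norm (A $$ (i, l))) {..<m} \<le> frobenius_norm A"
proof -
  have "(\<Sum>l<m. (norm (A $$ (i, l)))\<^sup>2) \<le> (\<Sum>i<n. \<Sum>l<m. (norm (A $$ (i, l)))\<^sup>2)"
    using assms(2) by (intro member_le_sum[where f = "\<lambda>i. \<Sum>l<m. (norm (A $$ (i, l)))\<^sup>2"])
      (auto intro: sum_nonneg)
  then show ?thesis
    using assms(1) by (auto simp: L2_set_def frobenius_norm_def)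
qed

lemma L2_set_col_le_frobenius_norm:
  assumes "A \<in> carrier_mat n m" "j < m"
  shows "L2_set (\<lambda>l. norm (A $$ (l, j))) {..<n} \<le> frobenius_norm A"
proof -
  have "(\<Sum>l<n. (norm (A $$ (l, j)))\<^sup>2) \<le> (\<Sum>l<n. \<Sum>j<m. (norm (A $$ (l, j)))\<^sup>2)"
    using assms(2) by (intro sum_mono member_le_sum[where f = "\<lambda>j. (norm (A $$ (_, j)))\<^sup>2"]) auto
  then show ?thesis
    using assms(1) by (auto simp: L2_set_def frobenius_norm_def)
qed

lemma norm_mult_mat_entry_le_frobenius:
  fixes A B :: "'a::real_normed_field mat"
  assumes "A \<in> carrier_mat n m" "B \<in> carrier_mat m k" "i < n" "j < k"
  shows "norm ((A * B) $$ (i, j)) \<le> frobenius_norm A * frobenius_norm B"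
proof -
  have "norm ((A * B) $$ (i, j)) \<le> (\<Sum>l<m. norm (A $$ (i, l)) * norm (B $$ (l, j)))"
    by (rule norm_mult_mat_entry_le[OF assms])
  also have "\<dots> \<le> L2_set (\<lambda>l. norm (A $$ (i, l))) {..<m} * L2_set (\<lambda>l. norm (B $$ (l, j))) {..<m}"
    using L2_set_mult_ineq[of "\<lambda>l. norm (A $$ (i, l))" "\<lambda>l. norm (B $$ (l, j))"] by simp
  also have "\<dots> \<le> frobenius_norm A * frobenius_norm B"
    using assms L2_set_row_le_frobenius_norm[OF assms(1,3)] L2_set_col_le_frobenius_norm[OF assms(2,4)]
    by (intro mult_mono) (auto simp: L2_set_nonneg intro: order_trans[OF L2_set_nonneg])
  finally show ?thesis .
qed

lemma frobenius_norm_nonneg: "0 \<le> frobenius_norm A"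
  by (simp add: frobenius_norm_def sum_nonneg)

lemma frobenius_norm_le_sum_norm:
  assumes "A \<in> carrier_mat n m"
  shows "frobenius_norm A \<le> (\<Sum>i<n. \<Sum>j<m. norm (A $$ (i, j)))"
proof -
  have "frobenius_norm A = L2_set (\<lambda>(i, j). norm (A $$ (i, j))) ({..<n} \<times> {..<m})"
    using assms by (auto simp: frobenius_norm_def L2_set_def sum.cartesian_product case_prod_unfold)
  also have "\<dots> \<le> (\<Sum>(i, j)\<in>{..<n} \<times> {..<m}. norm (A $$ (i, j)))"
    by (rule L2_set_le_sum) auto
  finally show ?thesis
    by (simp add: sum.cartesian_product)
qed

section \<open>Errors in the quad-tree recursion\<close>

definition quadrant :: "nat \<Rightarrow> 'a mat \<Rightarrow> nat \<Rightarrow> nat \<Rightarrow> 'a mat" where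
  "quadrant m A p q = mat m m (\<lambda>(i, j). A $$ (p * m + i, q * m + j))"

definition pruned_product ::
  "nat \<Rightarrow> real \<Rightarrow> 'a::real_normed_field mat \<Rightarrow> 'a mat \<Rightarrow> 'a mat" where
  "pruned_product k \<tau> X Y =
     (if frobenius_norm X * frobenius_norm Y \<ge> \<tau> then spamm_tree k \<tau> X Y else 0\<^sub>m (2 ^ k) (2 ^ k))"

lemma quadrant_carrier [simp]: "quadrant m A p q \<in> carrier_mat m m"
  by (simp add: quadrant_def)

lemma quadrant_entry [simp]:
  "i < m \<Longrightarrow> j < m \<Longrightarrow> quadrant m A p q $$ (i, j) = A $$ (p * m + i, q * m + j)"
  by (simp add: quadrant_def)

lemma split_block_quadrants:
  assumes "A \<in> carrier_mat (2 * m) (2 * m)"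
  shows "split_block A m m = (quadrant m A 0 0, quadrant m A 0 1, quadrant m A 1 0, quadrant m A 1 1)"
  using assms by (auto simp: split_block_def quadrant_def Let_def add.commute intro!: eq_matI)

lemma spamm_tree_Suc_quadrants:
  fixes A B :: "'a::real_normed_field mat" and \<tau> :: real
  assumes "A \<in> carrier_mat (2 ^ Suc k) (2 ^ Suc k)" "B \<in> carrier_mat (2 ^ Suc k) (2 ^ Suc k)"
  defines "P \<equiv> \<lambda>p q r. pruned_product k \<tau> (quadrant (2 ^ k) A p r) (quadrant (2 ^ k) B r q)"
  shows "spamm_tree (Suc k) \<tau> A B =
    four_block_mat (P 0 0 0 + P 0 0 1) (P 0 1 0 + P 0 1 1) (P 1 0 0 + P 1 0 1) (P 1 1 0 + P 1 1 1)"
  using assms(1,2) by (simp add: split_block_quadrants P_def pruned_product_def Let_def)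

lemma spamm_tree_carrier:
  fixes A B :: "'a::real_normed_field mat"
  assumes "A \<in> carrier_mat (2 ^ k) (2 ^ k)" "B \<in> carrier_mat (2 ^ k) (2 ^ k)"
  shows "spamm_tree k \<tau> A B \<in> carrier_mat (2 ^ k) (2 ^ k)"
  using assms
proof (induction k arbitrary: A B)
  case (Suc k)
  have "pruned_product k \<tau> X Y \<in> carrier_mat (2 ^ k) (2 ^ k)"
    if "X \<in> carrier_mat (2 ^ k) (2 ^ k)" "Y \<in> carrier_mat (2 ^ k) (2 ^ k)" for X Y :: "'a mat"
    using Suc.IH[OF that] by (simp add: pruned_product_def)
  then show ?case
    unfolding spamm_tree_Suc_quadrants[OF Suc.prems] power_Suc mult_2
    by (intro four_block_carrier_mat add_carrier_mat quadrant_carrier) auto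
qed simp

lemma pruned_product_carrier:
  assumes "X \<in> carrier_mat (2 ^ k) (2 ^ k)" "Y \<in> carrier_mat (2 ^ k) (2 ^ k)"
  shows "pruned_product k \<tau> X Y \<in> carrier_mat (2 ^ k) (2 ^ k)"
  using spamm_tree_carrier[OF assms] by (simp add: pruned_product_def)

lemma spamm_tree_Suc_entry:
  fixes A B :: "'a::real_normed_field mat"
  assumes "A \<in> carrier_mat (2 ^ Suc k) (2 ^ Suc k)" "B \<in> carrier_mat (2 ^ Suc k) (2 ^ Suc k)"
    and "p < 2" "q < 2" "i < 2 ^ k" "j < 2 ^ k"
  shows "spamm_tree (Suc k) \<tau> A B $$ (p * 2 ^ k + i, q * 2 ^ k + j) =
    (\<Sum>r<2. pruned_product k \<tau> (quadrant (2 ^ k) A p r) (quadrant (2 ^ k) B r q) $$ (i, j))"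
proof -
  have dims: "dim_row (pruned_product k \<tau> (quadrant (2 ^ k) A p r) (quadrant (2 ^ k) B r q)) = 2 ^ k"
    "dim_col (pruned_product k \<tau> (quadrant (2 ^ k) A p r) (quadrant (2 ^ k) B r q)) = 2 ^ k" for p q r
    using pruned_product_carrier[of "quadrant (2 ^ k) A p r" k "quadrant (2 ^ k) B r q" \<tau>] by auto
  have sum2: "(\<Sum>r<2. f r) = f 0 + f 1" for f :: "nat \<Rightarrow> 'a"
    by (simp add: numeral_2_eq_2)
  have "p = 0 \<or> p = 1" "q = 0 \<or> q = 1"
    using assms(3,4) by auto
  then show ?thesis
    unfolding spamm_tree_Suc_quadrants[OF assms(1,2)] sum2
    using assms(5,6) by (auto simp: dims)
qed

lemma sum_two_blocks:
  fixes f :: "nat \<Rightarrow> 'a::comm_monoid_add"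
  shows "(\<Sum>l<2 * m. f l) = (\<Sum>r<2. \<Sum>l<m. f (r * m + l))"
proof -
  have "(\<Sum>l<2 * m. f l) = (\<Sum>r<2. sum f {r * m..<r * m + m})"
    by (rule sum.nat_group[symmetric])
  moreover have "sum f {r * m..<r * m + m} = (\<Sum>l<m. f (r * m + l))" for r
    using sum.shift_bounds_nat_ivl[of f 0 "r * m" m] by (simp add: atLeast0LessThan add.commute)
  ultimately show ?thesis by simp
qed

lemma mult_mat_entry_quadrants:
  fixes A B :: "'a::real_normed_field mat"
  assumes "A \<in> carrier_mat (2 * m) (2 * m)" "B \<in> carrier_mat (2 * m) (2 * m)"
    and "p < 2" "q < 2" "i < m" "j < m"
  shows "(A * B) $$ (p * m + i, q * m + j) = (\<Sum>r<2. (quadrant m A p r * quadrant m B r q) $$ (i, j))"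
proof -
  have "p * m + i < 2 * m" "q * m + j < 2 * m"
    using assms(3-6) by (auto simp: less_2_cases_iff)
  then show ?thesis
    using assms by (simp only: mult_mat_entry sum_two_blocks quadrant_carrier quadrant_entry
        mult_mat_entry[OF quadrant_carrier quadrant_carrier] cong: sum.cong_simp) simp
qed

lemma index_in_quadrant:
  fixes i :: nat
  assumes "i < 2 ^ Suc k"
  obtains p i' where "i = p * 2 ^ k + i'" "p < 2" "i' < 2 ^ k"
proof (rule that)
  show "i = i div 2 ^ k * 2 ^ k + i mod 2 ^ k"
    by (rule div_mult_mod_eq[symmetric])
  show "i div 2 ^ k < 2" "i mod 2 ^ k < 2 ^ k"
    using assms by (simp_all add: less_mult_imp_div_less)
qed

text \<open>The difference of a block product and its computed value is the error of a smaller tree when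
  the pair is descended into, and the whole product when it is skipped; errors of the two pairs
  that meet in one quadrant add up.\<close>

lemma spamm_tree_Suc_error_le:
  fixes A B :: "'a::real_normed_field mat"
  assumes "A \<in> carrier_mat (2 ^ Suc k) (2 ^ Suc k)" "B \<in> carrier_mat (2 ^ Suc k) (2 ^ Suc k)"
    and "p < 2" "q < 2" "i < 2 ^ k" "j < 2 ^ k"
    and bound: "\<And>r X Y. r < 2 \<Longrightarrow> X = quadrant (2 ^ k) A p r \<Longrightarrow> Y = quadrant (2 ^ k) B r q \<Longrightarrow>
      norm ((X * Y) $$ (i, j) - pruned_product k \<tau> X Y $$ (i, j)) \<le> \<epsilon> r"
  shows "norm ((A * B) $$ (p * 2 ^ k + i, q * 2 ^ k + j)
      - spamm_tree (Suc k) \<tau> A B $$ (p * 2 ^ k + i, q * 2 ^ k + j)) \<le> (\<Sum>r<2. \<epsilon> r)"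
  unfolding spamm_tree_Suc_entry[OF assms(1-6)]
    mult_mat_entry_quadrants[OF assms(1,2)[unfolded power_Suc] assms(3-6)] sum_subtractf[symmetric]
  by (rule sum_norm_le) (simp add: bound)

text \<open>A skipped pair costs less than \<open>\<tau>\<close> in each entry, and the number of pairs that contribute to
  one entry doubles with every level.\<close>

lemma spamm_tree_error_le_threshold:
  fixes A B :: "'a::real_normed_field mat"
  assumes "0 \<le> \<tau>"
    and "A \<in> carrier_mat (2 ^ k) (2 ^ k)" "B \<in> carrier_mat (2 ^ k) (2 ^ k)" "i < 2 ^ k" "j < 2 ^ k"
  shows "norm ((A * B) $$ (i, j) - spamm_tree k \<tau> A B $$ (i, j)) \<le> 2 ^ k * \<tau>"
  using assms(2-)
proof (induction k arbitrary: A B i j)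
  case 0
  then show ?case using assms(1) by simp
next
  case (Suc k)
  obtain p i' where i: "i = p * 2 ^ k + i'" "p < 2" "i' < 2 ^ k"
    using Suc.prems(3) by (rule index_in_quadrant)
  obtain q j' where j: "j = q * 2 ^ k + j'" "q < 2" "j' < 2 ^ k"
    using Suc.prems(4) by (rule index_in_quadrant)
  have "norm ((X * Y) $$ (i', j') - pruned_product k \<tau> X Y $$ (i', j')) \<le> 2 ^ k * \<tau>"
    if "X = quadrant (2 ^ k) A p r" "Y = quadrant (2 ^ k) B r q" for r X Y
  proof -
    have XY: "X \<in> carrier_mat (2 ^ k) (2 ^ k)" "Y \<in> carrier_mat (2 ^ k) (2 ^ k)"
      using that by simp_all
    show ?thesis
    proof (cases "frobenius_norm X * frobenius_norm Y \<ge> \<tau>")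
      case True
      then show ?thesis
        using Suc.IH[OF XY i(3) j(3)] by (simp add: pruned_product_def)
    next
      case False
      have "norm ((X * Y) $$ (i', j')) \<le> 1 * \<tau>"
        using norm_mult_mat_entry_le_frobenius[OF XY i(3) j(3)] False by simp
      also have "\<dots> \<le> 2 ^ k * \<tau>"
        using assms(1) by (intro mult_right_mono) auto
      finally show ?thesis
        using False i(3) j(3) by (simp add: pruned_product_def)
    qed
  qed
  then have "norm ((A * B) $$ (i, j) - spamm_tree (Suc k) \<tau> A B $$ (i, j)) \<le> (\<Sum>r<(2::nat). 2 ^ k * \<tau>)"
    unfolding i(1) j(1) by (intro spamm_tree_Suc_error_le Suc.prems i j) auto
  then show ?case by simp
qed

text \<open>The error in an entry consists of some of the terms of the product, so the sum of the absolute
  values of all terms bounds it, for every threshold.\<close>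

lemma spamm_tree_error_le_abs_product:
  fixes A B :: "'a::real_normed_field mat"
  assumes "A \<in> carrier_mat (2 ^ k) (2 ^ k)" "B \<in> carrier_mat (2 ^ k) (2 ^ k)" "i < 2 ^ k" "j < 2 ^ k"
  shows "norm ((A * B) $$ (i, j) - spamm_tree k \<tau> A B $$ (i, j))
    \<le> (\<Sum>l<2 ^ k. norm (A $$ (i, l)) * norm (B $$ (l, j)))"
  using assms
proof (induction k arbitrary: A B i j)
  case 0
  then show ?case by simp
next
  case (Suc k)
  obtain p i' where i: "i = p * 2 ^ k + i'" "p < 2" "i' < 2 ^ k"
    using Suc.prems(3) by (rule index_in_quadrant)
  obtain q j' where j: "j = q * 2 ^ k + j'" "q < 2" "j' < 2 ^ k"
    using Suc.prems(4) by (rule index_in_quadrant)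
  have bound: "norm ((X * Y) $$ (i', j') - pruned_product k \<tau> X Y $$ (i', j'))
      \<le> (\<Sum>l<2 ^ k. norm (A $$ (i, r * 2 ^ k + l)) * norm (B $$ (r * 2 ^ k + l, j)))"
    if "X = quadrant (2 ^ k) A p r" "Y = quadrant (2 ^ k) B r q" for r X Y
  proof -
    have XY: "X \<in> carrier_mat (2 ^ k) (2 ^ k)" "Y \<in> carrier_mat (2 ^ k) (2 ^ k)"
      using that by simp_all
    have "norm ((X * Y) $$ (i', j') - pruned_product k \<tau> X Y $$ (i', j'))
        \<le> (\<Sum>l<2 ^ k. norm (X $$ (i', l)) * norm (Y $$ (l, j')))"
      using Suc.IH[OF XY i(3) j(3)] norm_mult_mat_entry_le[OF XY i(3) j(3)] i(3) j(3)
      by (simp add: pruned_product_def)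
    then show ?thesis
      using that i j by simp
  qed
  have "norm ((A * B) $$ (i, j) - spamm_tree (Suc k) \<tau> A B $$ (i, j))
      \<le> (\<Sum>r<2. \<Sum>l<2 ^ k. norm (A $$ (i, r * 2 ^ k + l)) * norm (B $$ (r * 2 ^ k + l, j)))"
    using bound unfolding i(1) j(1) by (intro spamm_tree_Suc_error_le Suc.prems i j) auto
  then show ?case
    by (simp only: power_Suc sum_two_blocks)
qed

section \<open>Padding to a power of two\<close>

definition tree_depth :: "nat \<Rightarrow> nat" where
  "tree_depth n = nat \<lceil>log 2 (real n)\<rceil>"

lemma le_two_power_tree_depth:
  assumes "1 \<le> n"
  shows "n \<le> 2 ^ tree_depth n"
proof -
  have "log 2 (real n) \<le> real (tree_depth n)"
    unfolding tree_depth_def by linarith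
  then have "real n \<le> 2 powr real (tree_depth n)"
    using assms by (subst (asm) log_le_iff) auto
  then show ?thesis
    by (simp add: powr_realpow flip: of_nat_le_iff)
qed

lemma zero_pad_carrier [simp]: "zero_pad N A \<in> carrier_mat N N"
  by (simp add: zero_pad_def)

lemma sum_zero_pad_mult:
  fixes A B :: "'a::zero mat" and f :: "'a \<Rightarrow> 'a \<Rightarrow> 'b::comm_monoid_add"
  assumes "A \<in> carrier_mat n n" "B \<in> carrier_mat n n" "n \<le> N" "i < n" "j < n" "f 0 0 = 0"
  shows "(\<Sum>l<N. f (zero_pad N A $$ (i, l)) (zero_pad N B $$ (l, j))) = (\<Sum>l<n. f (A $$ (i, l)) (B $$ (l, j)))"
  using assms by (intro sum.mono_neutral_cong_right) (auto simp: zero_pad_def)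

lemma spamm_carrier:
  assumes "A \<in> carrier_mat n n"
  shows "spamm \<tau> A B \<in> carrier_mat n n"
  using assms by (simp add: spamm_def leading_block_def Let_def)

lemma spamm_error_carrier:
  assumes "A \<in> carrier_mat n n"
  shows "spamm_error \<tau> A B \<in> carrier_mat n n"
  unfolding spamm_error_def by (rule minus_carrier_mat[OF spamm_carrier[OF assms]])

lemma spamm_error_entry:
  fixes A B :: "'a::real_normed_field mat"
  assumes "1 \<le> n" "A \<in> carrier_mat n n" "B \<in> carrier_mat n n" "i < n" "j < n"
  defines "N \<equiv> 2 ^ tree_depth n"
  shows "spamm_error \<tau> A B $$ (i, j) = (zero_pad N A * zero_pad N B) $$ (i, j)
    - spamm_tree (tree_depth n) \<tau> (zero_pad N A) (zero_pad N B) $$ (i, j)"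
proof -
  have nN: "n \<le> N"
    unfolding N_def by (rule le_two_power_tree_depth[OF assms(1)])
  have "(zero_pad N A * zero_pad N B) $$ (i, j) = (A * B) $$ (i, j)"
    using sum_zero_pad_mult[OF assms(2,3) nN assms(4,5), of "(*)"] nN assms(2-5)
    by (simp add: mult_mat_entry[OF zero_pad_carrier zero_pad_carrier] mult_mat_entry
        del: index_mult_mat)
  moreover have "spamm \<tau> A B $$ (i, j)
      = spamm_tree (tree_depth n) \<tau> (zero_pad N A) (zero_pad N B) $$ (i, j)"
    using assms by (simp add: spamm_def leading_block_def tree_depth_def Let_def)
  ultimately show ?thesis
    using spamm_carrier[OF assms(2), of \<tau> B] assms(4,5) by (simp add: spamm_error_def)
qed

lemma spamm_error_le_threshold:
  fixes A B :: "'a::real_normed_field mat"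
  assumes "0 \<le> \<tau>" "1 \<le> n" "A \<in> carrier_mat n n" "B \<in> carrier_mat n n" "i < n" "j < n"
  shows "norm (spamm_error \<tau> A B $$ (i, j)) \<le> 2 ^ tree_depth n * \<tau>"
  unfolding spamm_error_entry[OF assms(2-)]
  using assms le_two_power_tree_depth[OF assms(2)] by (intro spamm_tree_error_le_threshold) auto

lemma spamm_error_le_abs_product:
  fixes A B :: "'a::real_normed_field mat"
  assumes "1 \<le> n" "A \<in> carrier_mat n n" "B \<in> carrier_mat n n" "i < n" "j < n"
  shows "norm (spamm_error \<tau> A B $$ (i, j)) \<le> (\<Sum>l<n. norm (A $$ (i, l)) * norm (B $$ (l, j)))"
proof -
  define N :: nat where "N = 2 ^ tree_depth n"
  have nN: "n \<le> N"
    unfolding N_def by (rule le_two_power_tree_depth[OF assms(1)])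
  have "norm (spamm_error \<tau> A B $$ (i, j))
      \<le> (\<Sum>l<N. norm (zero_pad N A $$ (i, l)) * norm (zero_pad N B $$ (l, j)))"
    unfolding spamm_error_entry[OF assms] N_def
    using assms nN by (intro spamm_tree_error_le_abs_product) (auto simp: N_def)
  also have "\<dots> = (\<Sum>l<n. norm (A $$ (i, l)) * norm (B $$ (l, j)))"
    using sum_zero_pad_mult[OF assms(2,3) nN assms(4,5), of "\<lambda>x y. norm x * norm y"] by simp
  finally show ?thesis .
qed

section \<open>Uniform row sums of exponentials\<close>

lemma summable_powr_exp:
  fixes a \<beta> :: real
  assumes "0 < a"
  shows "summable (\<lambda>m. (real m + 1) powr \<beta> * exp (- a * real m))"
proof (rule summable_comparison_test_bigo)
  show "summable (\<lambda>m. norm (exp (- a / 2) ^ m))"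
    using assms by (simp add: summable_geometric)
  have "(\<lambda>m. (real m + 1) powr \<beta> * exp (- a * real m)) \<in> O(\<lambda>m. exp (- a / 2 * real m))"
    using assms by real_asymp
  then show "(\<lambda>m. (real m + 1) powr \<beta> * exp (- a * real m)) \<in> O(\<lambda>m. exp (- a / 2) ^ m)"
    by (simp only: exp_of_nat2_mult)
qed

text \<open>The indices at distance in \<open>[m, m + 1)\<close> number at most \<open>\<gamma> * (m + 1) powr \<beta>\<close> and contribute at most
  \<open>exp (- a * m)\<close> each; exponential decay beats polynomial growth.\<close>

lemma exponential_row_sum_bounded:
  assumes "finite_indices_around d" "\<And>n. n \<ge> 1 \<Longrightarrow> distance_function n (d n)" "0 < a"
  obtains S where "0 \<le> S" "\<And>n i. n \<ge> 1 \<Longrightarrow> i < n \<Longrightarrow> (\<Sum>l<n. exp (- a * d n i l)) \<le> S"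
proof -
  obtain \<gamma> \<beta> where \<gamma>: "\<gamma> > 0"
    and card: "\<And>n i R. n \<ge> 1 \<Longrightarrow> i < n \<Longrightarrow> R \<ge> 1 \<Longrightarrow>
      real (card (index_neighbourhood n (d n) i R)) \<le> \<gamma> * R powr \<beta>"
    using assms(1) unfolding finite_indices_around_def by metis
  define g where "g = (\<lambda>m. \<gamma> * ((real m + 1) powr \<beta> * exp (- a * real m)))"
  have g: "summable g" "\<And>m. 0 \<le> g m"
    using summable_powr_exp[OF assms(3)] \<gamma> unfolding g_def by (auto intro: summable_mult)
  have "(\<Sum>l<n. exp (- a * d n i l)) \<le> suminf g" if n: "n \<ge> 1" "i < n" for n i
  proof -
    define shell where "shell = (\<lambda>l. nat \<lfloor>d n i l\<rfloor>)"
    define M where "M = Suc (Max (shell ` {..<n}))"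
    have nonneg: "0 \<le> d n i l" if "l < n" for l
      using assms(2)[OF n(1)] n(2) that unfolding distance_function_def by blast
    have "shell ` {..<n} \<subseteq> {..<M}"
      by (auto simp: M_def less_Suc_eq_le)
    then have "(\<Sum>l<n. exp (- a * d n i l)) = (\<Sum>m<M. \<Sum>l | l \<in> {..<n} \<and> shell l = m. exp (- a * d n i l))"
      by (intro sum.group[symmetric]) auto
    also have "\<dots> \<le> (\<Sum>m<M. g m)"
    proof (rule sum_mono)
      fix m
      have "(\<Sum>l | l \<in> {..<n} \<and> shell l = m. exp (- a * d n i l))
          \<le> real (card {l \<in> {..<n}. shell l = m}) * exp (- a * real m)"
      proof (rule sum_bounded_above)
        fix l assume "l \<in> {l \<in> {..<n}. shell l = m}"
        then have "real m \<le> d n i l"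
          using nonneg[of l] unfolding shell_def by auto
        then show "exp (- a * d n i l) \<le> exp (- a * real m)"
          using assms(3) by simp
      qed
      also have "\<dots> \<le> (\<gamma> * (real m + 1) powr \<beta>) * exp (- a * real m)"
      proof (rule mult_right_mono)
        have "{l \<in> {..<n}. shell l = m} \<subseteq> index_neighbourhood n (d n) i (real m + 1)"
          unfolding shell_def index_neighbourhood_def by (auto; linarith)
        then have "card {l \<in> {..<n}. shell l = m} \<le> card (index_neighbourhood n (d n) i (real m + 1))"
          by (intro card_mono) (auto simp: index_neighbourhood_def)
        then show "real (card {l \<in> {..<n}. shell l = m}) \<le> \<gamma> * (real m + 1) powr \<beta>"
          using card[OF n, of "real m + 1"] by linarith
      qed simp
      finally show "(\<Sum>l | l \<in> {..<n} \<and> shell l = m. exp (- a * d n i l)) \<le> g m"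
        by (simp add: g_def mult.assoc)
    qed
    also have "\<dots> \<le> suminf g"
      using g by (intro sum_le_suminf) auto
    finally show ?thesis .
  qed
  then show thesis
    using that suminf_nonneg[OF g] by blast
qed

section \<open>Error bounds for matrices with exponential decay\<close>

text \<open>Of the exponent \<open>\<alpha> * (d i l + d l j)\<close>, one half is at least \<open>(\<alpha> / 2) * d i j\<close> by the triangle
  inequality and comes out of the sum; of the other half, the part with \<open>d i l\<close> is kept to make
  the sum converge.\<close>

lemma exponential_decay_product:
  assumes dist: "distance_function n d" and ij: "i < n" "j < n" and pos: "0 < \<alpha>" "0 < c1" "0 < c2"
    and a: "\<And>l. l < n \<Longrightarrow> 0 \<le> a l \<and> a l \<le> c1 * exp (- \<alpha> * d i l)"
    and b: "\<And>l. l < n \<Longrightarrow> 0 \<le> b l \<and> b l \<le> c2 * exp (- \<alpha> * d l j)"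
    and S: "(\<Sum>l<n. exp (- (\<alpha> / 2) * d i l)) \<le> S"
  shows "(\<Sum>l<n. a l * b l) \<le> c1 * c2 * S * exp (- (\<alpha> / 2) * d i j)"
proof -
  have "(\<Sum>l<n. a l * b l) \<le> (\<Sum>l<n. c1 * c2 * exp (- (\<alpha> / 2) * d i j) * exp (- (\<alpha> / 2) * d i l))"
  proof (rule sum_mono)
    fix l assume "l \<in> {..<n}"
    then have l: "l < n" by simp
    have "d i j \<le> d i l + d l j" "0 \<le> d l j"
      using dist ij l unfolding distance_function_def by blast+
    then have "\<alpha> / 2 * (d i j + d i l) \<le> \<alpha> / 2 * (2 * d i l + 2 * d l j)"
      using pos(1) by (intro mult_left_mono) auto
    then have "- \<alpha> * d i l + - \<alpha> * d l j \<le> - (\<alpha> / 2) * d i j + - (\<alpha> / 2) * d i l"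
      by (simp add: algebra_simps)
    then have exp_le: "exp (- \<alpha> * d i l) * exp (- \<alpha> * d l j)
        \<le> exp (- (\<alpha> / 2) * d i j) * exp (- (\<alpha> / 2) * d i l)"
      unfolding exp_add[symmetric] by simp
    have "a l * b l \<le> (c1 * exp (- \<alpha> * d i l)) * (c2 * exp (- \<alpha> * d l j))"
      using a[OF l] b[OF l] pos by (intro mult_mono) auto
    also have "\<dots> = c1 * c2 * (exp (- \<alpha> * d i l) * exp (- \<alpha> * d l j))"
      by (simp only: mult_ac)
    also have "\<dots> \<le> c1 * c2 * (exp (- (\<alpha> / 2) * d i j) * exp (- (\<alpha> / 2) * d i l))"
      using exp_le pos by (intro mult_left_mono) auto
    finally show "a l * b l \<le> c1 * c2 * exp (- (\<alpha> / 2) * d i j) * exp (- (\<alpha> / 2) * d i l)"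
      by (simp only: mult_ac)
  qed
  also have "\<dots> = c1 * c2 * exp (- (\<alpha> / 2) * d i j) * (\<Sum>l<n. exp (- (\<alpha> / 2) * d i l))"
    by (simp only: sum_distrib_left)
  also have "\<dots> \<le> c1 * c2 * exp (- (\<alpha> / 2) * d i j) * S"
    using S pos by (intro mult_left_mono) auto
  finally show ?thesis
    by (simp only: mult_ac)
qed

text \<open>Each row contributes at most \<open>K\<^sup>2 * S\<close> to the squared norm; squaring the entries doubles the decay
  rate, so the row sums of \<open>exp (- (2 * a) * d i j)\<close> are the relevant ones.\<close>

lemma frobenius_norm_le_sqrt_dim:
  assumes E: "E \<in> carrier_mat n n" and K: "0 \<le> K"
    and decay: "\<And>i j. i < n \<Longrightarrow> j < n \<Longrightarrow> norm (E $$ (i, j)) \<le> K * exp (- a * d i j)"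
    and S: "\<And>i. i < n \<Longrightarrow> (\<Sum>j<n. exp (- (2 * a) * d i j)) \<le> S"
  shows "frobenius_norm E \<le> K * sqrt S * sqrt (real n)"
proof -
  have "(\<Sum>i<n. \<Sum>j<n. (norm (E $$ (i, j)))\<^sup>2) \<le> (\<Sum>i<n. K\<^sup>2 * S)"
  proof (rule sum_mono)
    fix i assume "i \<in> {..<n}"
    then have i: "i < n" by simp
    have "(\<Sum>j<n. (norm (E $$ (i, j)))\<^sup>2) \<le> (\<Sum>j<n. (K * exp (- a * d i j))\<^sup>2)"
      using decay[OF i] by (intro sum_mono power_mono) auto
    also have "\<dots> = K\<^sup>2 * (\<Sum>j<n. exp (- (2 * a) * d i j))"
      by (simp add: power_mult_distrib sum_distrib_left mult.assoc flip: exp_double)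
    also have "\<dots> \<le> K\<^sup>2 * S"
      using S[OF i] by (intro mult_left_mono) auto
    finally show "(\<Sum>j<n. (norm (E $$ (i, j)))\<^sup>2) \<le> K\<^sup>2 * S" .
  qed
  then have "frobenius_norm E \<le> sqrt (real n * (K\<^sup>2 * S))"
    using E by (auto simp: frobenius_norm_def)
  also have "\<dots> = K * sqrt S * sqrt (real n)"
    using K by (simp add: real_sqrt_mult)
  finally show ?thesis .
qed

lemma spamm_error_frobenius_le_sqrt_dim:
  fixes A B :: "nat \<Rightarrow> 'a::real_normed_field mat"
  assumes A: "\<And>n. n \<ge> 1 \<Longrightarrow> A n \<in> carrier_mat n n"
    and B: "\<And>n. n \<ge> 1 \<Longrightarrow> B n \<in> carrier_mat n n"
    and dist: "\<And>n. n \<ge> 1 \<Longrightarrow> distance_function n (d n)"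
    and decay: "common_exponential_decay d A B"
    and around: "finite_indices_around d"
  shows "\<exists>K. \<forall>n\<ge>1. \<forall>\<tau>. frobenius_norm (spamm_error \<tau> (A n) (B n)) \<le> K * sqrt (real n)"
proof -
  obtain \<alpha> c1 c2 where pos: "\<alpha> > 0" "c1 > 0" "c2 > 0"
    and AB: "\<And>n i j. n \<ge> 1 \<Longrightarrow> i < n \<Longrightarrow> j < n \<Longrightarrow>
      norm (A n $$ (i, j)) \<le> c1 * exp (- \<alpha> * d n i j) \<and> norm (B n $$ (i, j)) \<le> c2 * exp (- \<alpha> * d n i j)"
    using decay unfolding common_exponential_decay_def by metis
  obtain S where S: "0 \<le> S" "\<And>n i. n \<ge> 1 \<Longrightarrow> i < n \<Longrightarrow> (\<Sum>l<n. exp (- (\<alpha> / 2) * d n i l)) \<le> S"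
    using exponential_row_sum_bounded[OF around dist, of "\<alpha> / 2"] pos(1) by auto
  obtain S' where S': "\<And>n i. n \<ge> 1 \<Longrightarrow> i < n \<Longrightarrow> (\<Sum>l<n. exp (- \<alpha> * d n i l)) \<le> S'"
    using exponential_row_sum_bounded[OF around dist pos(1)] by blast
  have "frobenius_norm (spamm_error \<tau> (A n) (B n)) \<le> c1 * c2 * S * sqrt S' * sqrt (real n)"
    if n: "n \<ge> 1" for n \<tau>
  proof (rule frobenius_norm_le_sqrt_dim[where a = "\<alpha> / 2" and d = "d n"])
    fix i j assume ij: "i < n" "j < n"
    have "norm (spamm_error \<tau> (A n) (B n) $$ (i, j))
        \<le> (\<Sum>l<n. norm (A n $$ (i, l)) * norm (B n $$ (l, j)))"
      by (rule spamm_error_le_abs_product[OF n A[OF n] B[OF n] ij])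
    also have "\<dots> \<le> c1 * c2 * S * exp (- (\<alpha> / 2) * d n i j)"
      using AB[OF n] ij by (intro exponential_decay_product[OF dist[OF n] ij pos] S(2) n) auto
    finally show "norm (spamm_error \<tau> (A n) (B n) $$ (i, j)) \<le> c1 * c2 * S * exp (- (\<alpha> / 2) * d n i j)" .
  qed (use spamm_error_carrier[OF A[OF n]] pos S(1) S'[OF n] in auto)
  then show ?thesis by blast
qed

lemma spamm_error_frobenius_le_threshold:
  fixes A B :: "'a::real_normed_field mat"
  assumes "0 \<le> \<tau>" "1 \<le> n" "A \<in> carrier_mat n n" "B \<in> carrier_mat n n"
  shows "frobenius_norm (spamm_error \<tau> A B) \<le> real n * real n * 2 ^ tree_depth n * \<tau>"
proof -
  have "frobenius_norm (spamm_error \<tau> A B) \<le> (\<Sum>i<n. \<Sum>j<n. norm (spamm_error \<tau> A B $$ (i, j)))"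
    by (rule frobenius_norm_le_sum_norm[OF spamm_error_carrier[OF assms(3)]])
  also have "\<dots> \<le> (\<Sum>i<n. \<Sum>j<n. 2 ^ tree_depth n * \<tau>)"
    using assms by (intro sum_mono spamm_error_le_threshold) auto
  finally show ?thesis by (simp add: mult_ac)
qed

theorem theorem3p6:
  fixes A B :: "nat \<Rightarrow> 'a::real_normed_field mat"
    and d :: "nat \<Rightarrow> nat \<Rightarrow> nat \<Rightarrow> real"
  assumes "\<And>n. n \<ge> 1 \<Longrightarrow> A n \<in> carrier_mat n n"
    and "\<And>n. n \<ge> 1 \<Longrightarrow> B n \<in> carrier_mat n n"
    and "\<And>n. n \<ge> 1 \<Longrightarrow> distance_function n (d n)"
    and "common_exponential_decay d A B"
    and "finite_indices_around d"
  shows "(\<forall>n\<ge>1. \<forall>i<n. \<forall>j<n.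
            (\<lambda>\<tau>. norm (spamm_error \<tau> (A n) (B n) $$ (i, j))) \<in> O[at_right 0](\<lambda>\<tau>. \<tau>))
       \<and> (\<forall>\<tau>>0. (\<lambda>n. frobenius_norm (spamm_error \<tau> (A n) (B n))) \<in> O(\<lambda>n. real n powr (1/2)))
       \<and> (\<forall>n\<ge>1. \<forall>p<2.
            (\<lambda>\<tau>. frobenius_norm (spamm_error \<tau> (A n) (B n))) \<in> O[at_right 0](\<lambda>\<tau>. \<tau> powr (p / 2)))"
proof (intro conjI allI impI)
  fix n i j :: nat assume n: "n \<ge> 1" and ij: "i < n" "j < n"
  have "eventually (\<lambda>\<tau>. norm (norm (spamm_error \<tau> (A n) (B n) $$ (i, j)))
      \<le> 2 ^ tree_depth n * norm \<tau>) (at_right (0::real))"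
    using eventually_at_right_less[of "0::real"]
  proof eventually_elim
    case (elim \<tau>)
    then show ?case
      using spamm_error_le_threshold[OF _ n assms(1,2)[OF n] ij, of \<tau>] by simp
  qed
  then show "(\<lambda>\<tau>. norm (spamm_error \<tau> (A n) (B n) $$ (i, j))) \<in> O[at_right 0](\<lambda>\<tau>. \<tau>)"
    by (rule bigoI)
next
  fix \<tau> :: real
  obtain K where K: "\<And>n. n \<ge> 1 \<Longrightarrow> frobenius_norm (spamm_error \<tau> (A n) (B n)) \<le> K * sqrt (real n)"
    using spamm_error_frobenius_le_sqrt_dim[OF assms] by blast
  have "eventually (\<lambda>n. norm (frobenius_norm (spamm_error \<tau> (A n) (B n)))
      \<le> K * norm (real n powr (1/2))) sequentially"
    using eventually_ge_at_top[of 1] by eventually_elim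
      (use K in \<open>simp add: frobenius_norm_nonneg powr_half_sqrt\<close>)
  then show "(\<lambda>n. frobenius_norm (spamm_error \<tau> (A n) (B n))) \<in> O(\<lambda>n. real n powr (1/2))"
    by (rule bigoI)
next
  fix n :: nat and p :: real assume n: "n \<ge> 1" and p: "p < 2"
  have "eventually (\<lambda>\<tau>. norm (frobenius_norm (spamm_error \<tau> (A n) (B n)))
      \<le> real n * real n * 2 ^ tree_depth n * norm \<tau>) (at_right (0::real))"
    using eventually_at_right_less[of "0::real"]
  proof eventually_elim
    case (elim \<tau>)
    then show ?case
      using spamm_error_frobenius_le_threshold[OF _ n assms(1,2)[OF n], of \<tau>]
      by (simp add: frobenius_norm_nonneg)
  qed
  then have "(\<lambda>\<tau>. frobenius_norm (spamm_error \<tau> (A n) (B n))) \<in> O[at_right 0](\<lambda>\<tau>. \<tau>)"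
    by (rule bigoI)
  also have "(\<lambda>\<tau>::real. \<tau>) \<in> O[at_right 0](\<lambda>\<tau>. \<tau> powr (p / 2))"
    using p by real_asymp
  finally show "(\<lambda>\<tau>. frobenius_norm (spamm_error \<tau> (A n) (B n))) \<in> O[at_right 0](\<lambda>\<tau>. \<tau> powr (p / 2))" .
qed

end
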